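(* Let $f \in \Gamma_0(\mathbb{R}^n)$ be a sparsity promoting function. Then the following statements hold: (i) For any $\alpha>0$, the function $f_\alpha := f-\mathrm{env}_{\alpha f}$ is a sparsity promoting function. Moreover, $\partial f_\alpha(0)=\partial f(0)$. (ii) Let $g: x \mapsto f(-x)$. Then, for any $\alpha>0$, both $g$ and $g_\alpha := g-\mathrm{env}_{\alpha g}$ are sparsity promoting. Moreover, $g_\alpha(x) = f_\alpha(-x)$ for all $x\in\mathbb{R}^n$ and $\partial g_\alpha(0)=-\partial f(0)$.
   Context: Functions on $\mathbb{R}^n$ take values in $(-\infty,+\infty]$; $\|\cdot\|$ is the Euclidean norm and $\langle\cdot,\cdot\rangle$ the standard inner product. $\Gamma(\mathbb{R}^n)$ denotes the proper lower semicontinuous functions, and $\Gamma_0(\mathbb{R}^n)$ the proper lower semicontinuous convex functions. For $g\in\Gamma(\mathbb{R}^n)$, $\partial g$ is the Fréchet subdifferential: for $x\in\mathrm{dom}(g)$, $\partial g(x)=\{d\in\mathbb{R}^n:\liminf_{u\to x}\frac{g(u)-g(x)-\langle d,u-x\rangle}{\|u-x\|}\ge 0\}$, and $\partial g(x)=\emptyset$ for $x\notin\mathrm{dom}(g)$. For $g \in \Gamma_0(\mathbb{R}^n)$ this is the usual convex subdifferential. The Moreau envelope with parameter $\alpha>0$ is $\mathrm{env}_{\alpha g}(x)=\inf_{u\in\mathbb{R}^n}\{g(u)+\frac{1}{2\alpha}\|u-x\|^2\}$. A function $f\in\Gamma(\mathbb{R}^n)$ is sparsity promoting if (i) $f(0)=0$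 and $f$ achieves its global minimum at the origin, and (ii) $\partial f(0)$ contains at least one nonzero element. *)

theory Defs
  imports "HOL-Analysis.Analysis"
begin

text \<open>
  Functions with values in the half-open extended line are modelled as \<^typ>\<open>ereal\<close>-valued
  functions that never take the value \<^term>\<open>-\<infinity> :: ereal\<close>; this requirement is part of properness.
\<close>

definition proper_fun :: "('a \<Rightarrow> ereal) \<Rightarrow> bool" where
  "proper_fun f \<longleftrightarrow> (\<forall>x. f x \<noteq> -\<infinity>) \<and> (\<exists>x. f x \<noteq> \<infinity>)"

definition lower_semicontinuous :: "('a::topological_space \<Rightarrow> ereal) \<Rightarrow> bool" where
  "lower_semicontinuous f \<longleftrightarrow> (\<forall>x. f x \<le> Liminf (at x) f)"

definition convex_ereal_fun :: "('a::real_vector \<Rightarrow> ereal) \<Rightarrow> bool" where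
  "convex_ereal_fun f \<longleftrightarrow>
     (\<forall>x y. \<forall>u\<ge>0. \<forall>v\<ge>0. u + v = 1 \<longrightarrow>
        f (u *\<^sub>R x + v *\<^sub>R y) \<le> ereal u * f x + ereal v * f y)"

definition Gamma_lsc :: "('a::topological_space \<Rightarrow> ereal) set" where
  "Gamma_lsc = {f. proper_fun f \<and> lower_semicontinuous f}"

definition Gamma_0 :: "('a::real_normed_vector \<Rightarrow> ereal) set" where
  "Gamma_0 = {f \<in> Gamma_lsc. convex_ereal_fun f}"

definition effective_dom :: "('a \<Rightarrow> ereal) \<Rightarrow> 'a set" where
  "effective_dom f = {x. f x < \<infinity>}"

text \<open>The filter \<^term>\<open>at x\<close> is punctured, so the quotient at the base point is irrelevant.\<close>

definition frechet_subdiff :: "('a::real_inner \<Rightarrow> ereal) \<Rightarrow> 'a \<Rightarrow> 'a set" where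
  "frechet_subdiff g x =
     (if x \<in> effective_dom g
      then {d. Liminf (at x) (\<lambda>u. (g u - g x - ereal (d \<bullet> (u - x))) / ereal (norm (u - x))) \<ge> 0}
      else {})"

definition moreau_env :: "real \<Rightarrow> ('a::real_normed_vector \<Rightarrow> ereal) \<Rightarrow> 'a \<Rightarrow> ereal" where
  "moreau_env \<alpha> g x = (INF u. g u + ereal (1 / (2 * \<alpha>) * (norm (u - x))\<^sup>2))"

text \<open>
  The difference of a function and its Moreau envelope. When \<open>g\<close> is proper and bounded below and
  \<open>\<alpha> > 0\<close>, the envelope is finite everywhere, so no difference of infinities occurs.
\<close>

definition env_diff :: "real \<Rightarrow> ('a::real_normed_vector \<Rightarrow> ereal) \<Rightarrow> 'a \<Rightarrow> ereal" where
  "env_diff \<alpha> g x = g x - moreau_env \<alpha> g x"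

definition sparsity_promoting :: "('a::real_inner \<Rightarrow> ereal) \<Rightarrow> bool" where
  "sparsity_promoting f \<longleftrightarrow>
     f \<in> Gamma_lsc \<and> f 0 = 0 \<and> (\<forall>x. f 0 \<le> f x) \<and> (\<exists>d \<in> frechet_subdiff f 0. d \<noteq> 0)"

end

theory Submission
  imports Defs
begin

text \<open>
  Since \<open>f\<close> is nonnegative and vanishes at the origin, testing the infimum that defines the
  envelope with \<open>u = x\<close> and with \<open>u = 0\<close> gives
  \<open>0 \<le> env x \<le> min (f x) (\<parallel>x\<parallel>\<^sup>2 / (2\<alpha>))\<close>.  Everything follows from this estimate:

  \<^item> \<open>f - env\<close> is nonnegative and vanishes at the origin, so its minimum is attained there.

  \<^item> The envelope is finite, and it is upper semicontinuous as an infimum of functions that are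
    continuous in \<open>x\<close>.  Hence subtracting it preserves lower semicontinuity
    (\<open>lower_semicontinuous_diff\<close>).

  \<^item> Near the origin \<open>f\<close> and \<open>f - env\<close> differ by \<open>O(\<parallel>x\<parallel>\<^sup>2)\<close>.  A Frechet subdifferential does not
    see perturbations of order \<open>o(\<parallel>x\<parallel>)\<close>, so both functions have the same one at the origin
    (\<open>frechet_subdiff_quadratic_perturbation\<close>); in particular a nonzero subgradient survives.

  The second part is the observation that the isometry \<open>x \<mapsto> - x\<close> commutes with all constructions
  involved and acts on subgradients by negation.
\<close>

section \<open>Lower semicontinuity\<close>

lemma lower_semicontinuous_iff:
  "lower_semicontinuous f \<longleftrightarrow> (\<forall>x. \<forall>y<f x. \<forall>\<^sub>F u in at x. y < f u)"
  unfolding lower_semicontinuous_def le_Liminf_iff ..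

text \<open>
  The second hypothesis is upper semicontinuity of \<open>e\<close>.  A real number strictly between
  \<open>y + e x\<close> and \<open>f x\<close> serves as a threshold that separates the two functions near \<open>x\<close>.
\<close>

lemma lower_semicontinuous_diff:
  fixes f :: "'a::topological_space \<Rightarrow> ereal" and e :: "'a \<Rightarrow> ereal"
  assumes f: "lower_semicontinuous f"
    and e: "\<And>x c. e x < c \<Longrightarrow> \<forall>\<^sub>F u in at x. e u < c"
    and fin: "\<And>x. \<bar>e x\<bar> \<noteq> \<infinity>" and f_ninf: "\<And>x. f x \<noteq> -\<infinity>"
  shows "lower_semicontinuous (\<lambda>x. f x - e x)"
  unfolding lower_semicontinuous_iff
proof (intro allI impI)
  fix x y assume y: "y < f x - e x"
  show "\<forall>\<^sub>F u in at x. y < f u - e u"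
  proof (cases y)
    case (real b)
    obtain a where a: "e x = ereal a" using fin[of x] by auto
    have "ereal (b + a) < f x" using y real a by (cases "f x") auto
    then obtain r where r: "ereal (b + a) < ereal r" "ereal r < f x"
      using ereal_dense2 by blast
    have "\<forall>\<^sub>F u in at x. ereal r < f u"
      using f r(2) unfolding lower_semicontinuous_iff by blast
    moreover have "\<forall>\<^sub>F u in at x. e u < ereal (r - b)"
      using r(1) a by (intro e) auto
    ultimately show ?thesis
    proof eventually_elim
      case (elim u)
      then show ?case using fin[of u] real by (cases "f u"; cases "e u") auto
    qed
  next
    case PInf
    then show ?thesis using y by simp
  next
    case MInf
    have "-\<infinity> < f u - e u" for u
      using fin[of u] f_ninf[of u] by (cases "f u"; cases "e u") auto
    then show ?thesis using MInf by simp
  qed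
qed

section \<open>The Frechet subdifferential\<close>

text \<open>
  Clearing the denominator turns the limit inferior into affine minorants with a linear error term.
  In this form values of functions are compared directly, without quotients of extended reals, as
  the perturbation and reflection arguments below require.
\<close>

lemma mem_frechet_subdiff_iff:
  fixes f :: "'a::real_inner \<Rightarrow> ereal"
  assumes fx: "f x = ereal c"
  shows "d \<in> frechet_subdiff f x \<longleftrightarrow>
    (\<forall>\<epsilon>>0. \<forall>\<^sub>F u in at x. ereal (c + d \<bullet> (u - x) - \<epsilon> * norm (u - x)) \<le> f u)"
    (is "_ \<longleftrightarrow> ?R")
proof -
  let ?Q = "\<lambda>u. (f u - f x - ereal (d \<bullet> (u - x))) / ereal (norm (u - x))"
  have Q: "(ereal r \<le> ?Q u \<longleftrightarrow> ereal (c + d \<bullet> (u - x) + r * norm (u - x)) \<le> f u)" if "u \<noteq> x" for u r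
  proof -
    have "norm (u - x) > 0" using that by simp
    then show ?thesis using fx by (cases "f u") (auto simp: field_simps)
  qed
  have "d \<in> frechet_subdiff f x \<longleftrightarrow> (\<forall>y<0. \<forall>\<^sub>F u in at x. y < ?Q u)"
    unfolding frechet_subdiff_def effective_dom_def using fx by (simp add: le_Liminf_iff)
  also have "\<dots> \<longleftrightarrow> ?R"
  proof safe
    fix \<epsilon> :: real assume *: "\<forall>y<0. \<forall>\<^sub>F u in at x. y < ?Q u" and "\<epsilon> > 0"
    then have "\<forall>\<^sub>F u in at x. ereal (-\<epsilon>) < ?Q u" by simp
    moreover have "\<forall>\<^sub>F u in at x. u \<noteq> x" by (rule eventually_neq_at_within)
    ultimately show "\<forall>\<^sub>F u in at x. ereal (c + d \<bullet> (u - x) - \<epsilon> * norm (u - x)) \<le> f u"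
    proof eventually_elim
      case (elim u)
      then show ?case using Q[of u "-\<epsilon>"] by (simp add: less_imp_le)
    qed
  next
    fix y :: ereal assume R: ?R and "y < 0"
    then obtain r where r: "y < ereal r" "ereal r < 0" using ereal_dense2 by blast
    have "\<forall>\<^sub>F u in at x. ereal (c + d \<bullet> (u - x) - (-r) * norm (u - x)) \<le> f u"
      using R r(2) by (metis ereal_less(1) neg_0_less_iff_less)
    moreover have "\<forall>\<^sub>F u in at x. u \<noteq> x" by (rule eventually_neq_at_within)
    ultimately show "\<forall>\<^sub>F u in at x. y < ?Q u"
    proof eventually_elim
      case (elim u)
      then have "ereal r \<le> ?Q u" using Q[of u r] by simp
      then show ?case using r(1) by (rule less_le_trans[rotated])
    qed
  qed
  finally show ?thesis .
qed

text \<open>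
  The quadratic error is absorbed by half of the linear slack \<open>\<epsilon> * norm (u - x)\<close> as soon as
  \<open>K * norm (u - x) \<le> \<epsilon> / 2\<close>.
\<close>

lemma frechet_subdiff_quadratic_perturbation:
  fixes f h :: "'a::real_inner \<Rightarrow> ereal"
  assumes fx: "f x = ereal c" and hx: "h x = ereal c"
    and le: "\<And>u. h u \<le> f u"
    and ge: "\<And>u. f u \<le> h u + ereal (K * (norm (u - x))\<^sup>2)"
  shows "frechet_subdiff h x = frechet_subdiff f x"
proof (intro set_eqI iffI)
  fix d assume "d \<in> frechet_subdiff h x"
  then show "d \<in> frechet_subdiff f x"
    unfolding mem_frechet_subdiff_iff[of f, OF fx] mem_frechet_subdiff_iff[of h, OF hx]
    by (fast elim: eventually_mono intro: order_trans le)
next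
  fix d assume d: "d \<in> frechet_subdiff f x"
  show "d \<in> frechet_subdiff h x"
    unfolding mem_frechet_subdiff_iff[of h, OF hx]
  proof (intro allI impI)
    fix \<epsilon> :: real assume \<epsilon>: "\<epsilon> > 0"
    have "((\<lambda>u. K * norm (u - x)) \<longlongrightarrow> K * norm (x - x)) (at x)"
      by (intro tendsto_intros)
    then have "\<forall>\<^sub>F u in at x. K * norm (u - x) < \<epsilon> / 2"
      using \<epsilon> by (intro order_tendstoD(2)) auto
    moreover have "\<forall>\<^sub>F u in at x. ereal (c + d \<bullet> (u - x) - \<epsilon> / 2 * norm (u - x)) \<le> f u"
      using d \<epsilon> unfolding mem_frechet_subdiff_iff[of f, OF fx] by (meson half_gt_zero)
    ultimately show "\<forall>\<^sub>F u in at x. ereal (c + d \<bullet> (u - x) - \<epsilon> * norm (u - x)) \<le> h u"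
    proof eventually_elim
      case (elim u)
      have "K * norm (u - x) * norm (u - x) \<le> \<epsilon> / 2 * norm (u - x)"
        using elim(1) by (intro mult_right_mono) auto
      then have K: "K * (norm (u - x))\<^sup>2 \<le> \<epsilon> / 2 * norm (u - x)"
        by (simp add: power2_eq_square mult.assoc)
      have "ereal (c + d \<bullet> (u - x) - \<epsilon> / 2 * norm (u - x)) \<le> h u + ereal (K * (norm (u - x))\<^sup>2)"
        using elim(2) ge[of u] by (rule order_trans)
      then show ?case using K by (cases "h u") auto
    qed
  qed
qed

section \<open>The Moreau envelope\<close>

lemma moreau_env_le: "moreau_env \<alpha> f x \<le> f u + ereal (1 / (2 * \<alpha>) * (norm (u - x))\<^sup>2)"
  unfolding moreau_env_def by (rule INF_lower) simp

text \<open>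
  A single \<open>v\<close> that brings the infimum at \<open>x\<close> below \<open>c\<close> still does so at nearby points, because
  \<open>f v\<close> does not depend on the point and the quadratic term is continuous in it.
\<close>

lemma moreau_env_upper_semicontinuous:
  fixes f :: "'a::real_normed_vector \<Rightarrow> ereal"
  assumes "moreau_env \<alpha> f x < c"
  shows "\<forall>\<^sub>F u in at x. moreau_env \<alpha> f u < c"
proof -
  let ?q = "\<lambda>v u. 1 / (2 * \<alpha>) * (norm (v - u))\<^sup>2"
  obtain v where v: "f v + ereal (?q v x) < c"
    using assms unfolding moreau_env_def INF_less_iff by blast
  have "((\<lambda>u. ?q v u) \<longlongrightarrow> ?q v x) (at x)"
    by (intro tendsto_intros)
  then have "((\<lambda>u. f v + ereal (?q v u)) \<longlongrightarrow> f v + ereal (?q v x)) (at x)"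
    by (intro tendsto_add_ereal_general) auto
  then have "\<forall>\<^sub>F u in at x. f v + ereal (?q v u) < c"
    using v by (rule order_tendstoD(2))
  then show ?thesis
    by eventually_elim (rule le_less_trans[OF moreau_env_le])
qed

lemma env_diff_reflect:
  fixes f :: "'a::real_normed_vector \<Rightarrow> ereal"
  shows "env_diff \<alpha> (\<lambda>x. f (- x)) x = env_diff \<alpha> f (- x)"
proof -
  have norm_reflect: "norm (- u - x) = norm (u - - x)" for u
    using norm_minus_cancel[of "u + x"] by simp
  have "moreau_env \<alpha> (\<lambda>x. f (- x)) x = moreau_env \<alpha> f (- x)"
    unfolding moreau_env_def
  proof (rule INF_eq)
    fix u
    show "\<exists>v\<in>UNIV. f v + ereal (1 / (2 * \<alpha>) * (norm (v - - x))\<^sup>2)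
        \<le> f (- u) + ereal (1 / (2 * \<alpha>) * (norm (u - x))\<^sup>2)"
      using norm_reflect[of "- u"] by (intro bexI[of _ "- u"]) auto
    show "\<exists>v\<in>UNIV. f (- v) + ereal (1 / (2 * \<alpha>) * (norm (v - x))\<^sup>2)
        \<le> f u + ereal (1 / (2 * \<alpha>) * (norm (u - - x))\<^sup>2)"
      using norm_reflect[of u] by (intro bexI[of _ "- u"]) auto
  qed
  then show ?thesis unfolding env_diff_def by simp
qed

section \<open>Subtracting the envelope from a sparsity promoting function\<close>

context
  fixes f :: "'a::real_inner \<Rightarrow> ereal" and \<alpha> :: real
  assumes sp: "sparsity_promoting f" and \<alpha>: "\<alpha> > 0"
begin

lemma sparsity_promoting_nonneg: "0 \<le> f x"
  using sp unfolding sparsity_promoting_def by metis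

lemma moreau_env_nonneg: "0 \<le> moreau_env \<alpha> f x"
  unfolding moreau_env_def using \<alpha> sparsity_promoting_nonneg
  by (intro INF_greatest add_nonneg_nonneg) auto

lemma moreau_env_le_quadratic: "moreau_env \<alpha> f x \<le> ereal (1 / (2 * \<alpha>) * (norm x)\<^sup>2)"
  using moreau_env_le[of \<alpha> f x 0] sp unfolding sparsity_promoting_def by simp

lemma moreau_env_finite: "\<bar>moreau_env \<alpha> f x\<bar> \<noteq> \<infinity>"
  using moreau_env_nonneg[of x] moreau_env_le_quadratic[of x] by (cases "moreau_env \<alpha> f x") auto

lemma env_diff_nonneg: "0 \<le> env_diff \<alpha> f x"
proof -
  have "moreau_env \<alpha> f x \<le> f x" using moreau_env_le[of \<alpha> f x x] by simp
  then show ?thesis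
    unfolding env_diff_def using moreau_env_finite[of x]
    by (cases "f x"; cases "moreau_env \<alpha> f x") auto
qed

lemma env_diff_zero: "env_diff \<alpha> f 0 = 0"
proof -
  have "moreau_env \<alpha> f 0 = 0"
    using moreau_env_nonneg[of 0] moreau_env_le_quadratic[of 0] by (simp add: zero_ereal_def)
  then show ?thesis
    using sp unfolding env_diff_def sparsity_promoting_def by simp
qed

lemma frechet_subdiff_env_diff_zero: "frechet_subdiff (env_diff \<alpha> f) 0 = frechet_subdiff f 0"
proof (rule frechet_subdiff_quadratic_perturbation[where c = 0 and K = "1 / (2 * \<alpha>)"])
  show "f 0 = ereal 0" "env_diff \<alpha> f 0 = ereal 0"
    using sp env_diff_zero unfolding sparsity_promoting_def by (auto simp: zero_ereal_def)
  fix u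
  show "env_diff \<alpha> f u \<le> f u"
    unfolding env_diff_def using moreau_env_finite[of u] moreau_env_nonneg[of u]
    by (cases "f u"; cases "moreau_env \<alpha> f u") auto
  show "f u \<le> env_diff \<alpha> f u + ereal (1 / (2 * \<alpha>) * (norm (u - 0))\<^sup>2)"
    unfolding env_diff_def using moreau_env_finite[of u] moreau_env_le_quadratic[of u]
    by (cases "f u"; cases "moreau_env \<alpha> f u") auto
qed

lemma sparsity_promoting_env_diff: "sparsity_promoting (env_diff \<alpha> f)"
proof -
  have "lower_semicontinuous f"
    using sp unfolding sparsity_promoting_def Gamma_lsc_def by simp
  moreover have "f x \<noteq> -\<infinity>" for x using sparsity_promoting_nonneg[of x] by auto
  ultimately have "lower_semicontinuous (env_diff \<alpha> f)"
    unfolding env_diff_def[abs_def]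
    using moreau_env_upper_semicontinuous moreau_env_finite
    by (intro lower_semicontinuous_diff) auto
  moreover have "proper_fun (env_diff \<alpha> f)"
    unfolding proper_fun_def
  proof (intro conjI allI exI)
    show "env_diff \<alpha> f x \<noteq> -\<infinity>" for x using env_diff_nonneg[of x] by auto
    show "env_diff \<alpha> f 0 \<noteq> \<infinity>" by (simp add: env_diff_zero)
  qed
  ultimately show ?thesis
    using sp env_diff_zero env_diff_nonneg frechet_subdiff_env_diff_zero
    unfolding sparsity_promoting_def Gamma_lsc_def by simp
qed

end

section \<open>Reflection at the origin\<close>

lemma eventually_at_reflect:
  fixes x :: "'a::real_normed_vector"
  shows "(\<forall>\<^sub>F u in at x. P (- u)) \<longleftrightarrow> (\<forall>\<^sub>F u in at (- x). P u)"
  using eventually_filtermap[of P uminus "at x"] by (simp add: filtermap_at_minus)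

lemma lower_semicontinuous_reflect:
  fixes f :: "'a::real_normed_vector \<Rightarrow> ereal"
  assumes "lower_semicontinuous f"
  shows "lower_semicontinuous (\<lambda>x. f (- x))"
  using assms unfolding lower_semicontinuous_iff eventually_at_reflect[where P = "\<lambda>u. _ < f u"]
  by blast

lemma frechet_subdiff_reflect_zero:
  fixes f :: "'a::real_inner \<Rightarrow> ereal"
  assumes f0: "f 0 = ereal c"
  shows "frechet_subdiff (\<lambda>x. f (- x)) 0 = uminus ` frechet_subdiff f 0"
proof -
  have g0: "f (- 0) = ereal c" using f0 by simp
  have "d \<in> frechet_subdiff (\<lambda>x. f (- x)) 0 \<longleftrightarrow> - d \<in> frechet_subdiff f 0" for d
    unfolding mem_frechet_subdiff_iff[of f, OF f0] mem_frechet_subdiff_iff[of "\<lambda>x. f (- x)", OF g0]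
    using eventually_at_reflect[of "\<lambda>u. ereal (c + - d \<bullet> (u - 0) - _ * norm (u - 0)) \<le> f u" 0]
    by simp
  then show ?thesis by (force simp: image_iff)
qed

lemma sparsity_promoting_reflect:
  fixes f :: "'a::real_inner \<Rightarrow> ereal"
  assumes sp: "sparsity_promoting f"
  shows "sparsity_promoting (\<lambda>x. f (- x))"
proof -
  have f0: "f 0 = 0" and proper: "proper_fun f" and lsc: "lower_semicontinuous f"
    using sp unfolding sparsity_promoting_def Gamma_lsc_def by auto
  have "proper_fun (\<lambda>x. f (- x))"
    using proper unfolding proper_fun_def by (metis minus_minus)
  then show ?thesis
    using sp lower_semicontinuous_reflect[OF lsc] frechet_subdiff_reflect_zero[of f 0] f0
    unfolding sparsity_promoting_def Gamma_lsc_def by (auto simp: zero_ereal_def)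
qed

theorem theorem1:
  fixes f g :: "real ^ 'n \<Rightarrow> ereal"
  assumes "f \<in> Gamma_0"
    and "sparsity_promoting f"
    and g_def: "g = (\<lambda>x. f (- x))"
  shows "(\<forall>\<alpha>>0. sparsity_promoting (env_diff \<alpha> f) \<and>
            frechet_subdiff (env_diff \<alpha> f) 0 = frechet_subdiff f 0) \<and>
         (\<forall>\<alpha>>0. sparsity_promoting g \<and> sparsity_promoting (env_diff \<alpha> g) \<and>
            (\<forall>x. env_diff \<alpha> g x = env_diff \<alpha> f (- x)) \<and>
            frechet_subdiff (env_diff \<alpha> g) 0 = uminus ` frechet_subdiff f 0)"
proof -
  have g: "sparsity_promoting g"
    unfolding g_def using assms(2) by (rule sparsity_promoting_reflect)
  have "f 0 = ereal 0"
    using assms(2) unfolding sparsity_promoting_def by (simp add: zero_ereal_def)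
  then have "frechet_subdiff g 0 = uminus ` frechet_subdiff f 0"
    unfolding g_def by (rule frechet_subdiff_reflect_zero)
  then show ?thesis
    using sparsity_promoting_env_diff[OF assms(2)] frechet_subdiff_env_diff_zero[OF assms(2)]
      sparsity_promoting_env_diff[OF g] frechet_subdiff_env_diff_zero[OF g] g
      env_diff_reflect[of _ f] unfolding g_def by simp
qed

end
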